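(* Let $a>0$, let $N(0,a)$ be the normal law on $\mathbb R$ with zero mean and variance $a$, and $P_a$ the Poisson law on $\mathbb Z_+$ with parameter $a$. Let $\Phi:L^2(\mathbb R,N(0,a))\to L^2(\mathbb Z_+,P_a)$ be the unitary isomorphism determined by $\Phi(H_n^a)=C_n^a$, $n\ge0$ (equivalently, $e^{tx-\frac{at^2}{2}}\mapsto\{e^{-at}(1+t)^k\}_{k\ge0}$ for all $t\in\mathbb R$). Then its kernel, i.e. the function $K^a$ on $\mathbb Z_+\times\mathbb R$ such that $$(\Phi^{-1}F)(x)=\sum_{k=0}^\infty K^a(k,x)F(k)\,e^{-a}\frac{a^k}{k!},\qquad F\in L^2(\mathbb Z_+,P_a)$$ (with convergence in $L^2(\mathbb R,N(0,a))$), is given by $$K^a(k,x)=e^{-\frac a2-x}\,\frac{H_k^a(x+2a)}{a^k}.$$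
   Context: Hermite polynomials: $H_n(x)=(-1)^ne^{x^2/2}\frac{d^n}{dx^n}e^{-x^2/2}$, $H_n^a(x)=a^{n/2}H_n(x/\sqrt a)$; they satisfy $\sum_{n\ge0}H_n^a(x)\frac{t^n}{n!}=e^{tx-\frac{t^2a}2}$ and are orthogonal with respect to $N(0,a)$ with squared norm $a^nn!$. Charlier polynomials: $C_n^a(x)=a^n\sum_{j=0}^n(-1)^{n-j}\binom nj a^{-j}\binom xj j!$; they satisfy $\sum_{n\ge0}C_n^a(y)\frac{t^n}{n!}=(1+t)^ye^{-ta}$ and are orthogonal with respect to $P_a$ with squared norm $a^nn!$. *)

theory Defs
  imports "HOL-Probability.Probability"
begin

definition hermite :: "nat \<Rightarrow> real \<Rightarrow> real" where
  "hermite n x = (-1) ^ n * exp (x\<^sup>2 / 2) * (deriv ^^ n) (\<lambda>y. exp (- y\<^sup>2 / 2)) x"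

definition hermite_var :: "real \<Rightarrow> nat \<Rightarrow> real \<Rightarrow> real" where
  "hermite_var a n x = a powr (real n / 2) * hermite n (x / sqrt a)"

definition charlier :: "real \<Rightarrow> nat \<Rightarrow> real \<Rightarrow> real" where
  "charlier a n x =
     a ^ n * (\<Sum>j=0..n. (-1) ^ (n - j) * real (n choose j) * inverse (a ^ j) * (x gchoose j) * fact j)"

definition normal_law :: "real \<Rightarrow> real measure" where
  "normal_law a = density lborel (\<lambda>x. ennreal (normal_density 0 (sqrt a) x))"

definition poisson_law :: "real \<Rightarrow> nat measure" where
  "poisson_law a = measure_pmf (poisson_pmf a)"

text \<open>
  Complex \<open>L\<^sup>2\<close> spaces are handled through representatives: \<open>L2 M\<close> is the set of
  square-integrable functions, and equality of elements of the Hilbert space is \<open>ae_eq M\<close>.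
\<close>

definition L2 :: "'a measure \<Rightarrow> ('a \<Rightarrow> complex) set" where
  "L2 M = {f \<in> borel_measurable M. integrable M (\<lambda>x. (cmod (f x))\<^sup>2)}"

definition ae_eq :: "'a measure \<Rightarrow> ('a \<Rightarrow> complex) \<Rightarrow> ('a \<Rightarrow> complex) \<Rightarrow> bool" where
  "ae_eq M f g \<longleftrightarrow> (AE x in M. f x = g x)"

definition inner_L2 :: "'a measure \<Rightarrow> ('a \<Rightarrow> complex) \<Rightarrow> ('a \<Rightarrow> complex) \<Rightarrow> complex" where
  "inner_L2 M f g = (LINT x|M. f x * cnj (g x))"

definition norm_L2 :: "'a measure \<Rightarrow> ('a \<Rightarrow> complex) \<Rightarrow> real" where
  "norm_L2 M f = sqrt (LINT x|M. (cmod (f x))\<^sup>2)"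

text \<open>
  Membership in \<open>L2 M\<close> is part of the definition of convergence, since \<open>norm_L2\<close> of a function
  that is not square-integrable is \<open>0\<close>.
\<close>

definition L2_converges :: "'a measure \<Rightarrow> (nat \<Rightarrow> 'a \<Rightarrow> complex) \<Rightarrow> ('a \<Rightarrow> complex) \<Rightarrow> bool" where
  "L2_converges M S f \<longleftrightarrow>
     (\<forall>n. S n \<in> L2 M) \<and> f \<in> L2 M \<and> (\<lambda>n. norm_L2 M (\<lambda>x. S n x - f x)) \<longlonglongrightarrow> 0"

text \<open>
  The first two conjuncts say that the map on representatives descends to the spaces of
  almost-everywhere classes; injectivity there follows from preservation of the inner product.
\<close>

definition unitary_L2 ::
  "'a measure \<Rightarrow> 'b measure \<Rightarrow> (('a \<Rightarrow> complex) \<Rightarrow> ('b \<Rightarrow> complex)) \<Rightarrow> bool" where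
  "unitary_L2 M N \<Phi> \<longleftrightarrow>
     (\<forall>f\<in>L2 M. \<Phi> f \<in> L2 N) \<and>
     (\<forall>f\<in>L2 M. \<forall>g\<in>L2 M. ae_eq M f g \<longrightarrow> ae_eq N (\<Phi> f) (\<Phi> g)) \<and>
     (\<forall>f\<in>L2 M. \<forall>g\<in>L2 M. \<forall>c d.
        ae_eq N (\<Phi> (\<lambda>x. c * f x + d * g x)) (\<lambda>y. c * \<Phi> f y + d * \<Phi> g y)) \<and>
     (\<forall>f\<in>L2 M. \<forall>g\<in>L2 M. inner_L2 N (\<Phi> f) (\<Phi> g) = inner_L2 M f g) \<and>
     (\<forall>h\<in>L2 N. \<exists>f\<in>L2 M. ae_eq N (\<Phi> f) h)"

text \<open>A representative of \<open>\<Phi>\<^sup>-\<^sup>1 h\<close>, unique up to \<open>ae_eq M\<close> when \<open>\<Phi>\<close> is unitary.\<close>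

definition inv_L2 ::
  "'a measure \<Rightarrow> 'b measure \<Rightarrow> (('a \<Rightarrow> complex) \<Rightarrow> ('b \<Rightarrow> complex)) \<Rightarrow> ('b \<Rightarrow> complex) \<Rightarrow> ('a \<Rightarrow> complex)"
  where "inv_L2 M N \<Phi> h = (SOME f. f \<in> L2 M \<and> ae_eq N (\<Phi> f) h)"

definition maps_hermite_to_charlier ::
  "real \<Rightarrow> ((real \<Rightarrow> complex) \<Rightarrow> (nat \<Rightarrow> complex)) \<Rightarrow> bool" where
  "maps_hermite_to_charlier a \<Phi> \<longleftrightarrow>
     (\<forall>n. ae_eq (poisson_law a)
        (\<Phi> (\<lambda>x. of_real (hermite_var a n x))) (\<lambda>k. of_real (charlier a n (real k))))"

definition maps_exponentials ::
  "real \<Rightarrow> ((real \<Rightarrow> complex) \<Rightarrow> (nat \<Rightarrow> complex)) \<Rightarrow> bool" where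
  "maps_exponentials a \<Phi> \<longleftrightarrow>
     (\<forall>t::real. ae_eq (poisson_law a)
        (\<Phi> (\<lambda>x. of_real (exp (t * x - a * t\<^sup>2 / 2)))) (\<lambda>k. of_real (exp (- a * t) * (1 + t) ^ k)))"

definition is_kernel_of_inverse ::
  "real \<Rightarrow> ((real \<Rightarrow> complex) \<Rightarrow> (nat \<Rightarrow> complex)) \<Rightarrow> (nat \<Rightarrow> real \<Rightarrow> complex) \<Rightarrow> bool" where
  "is_kernel_of_inverse a \<Phi> K \<longleftrightarrow>
     (\<forall>F\<in>L2 (poisson_law a).
        L2_converges (normal_law a)
          (\<lambda>n x. \<Sum>k<n. K k x * F k * of_real (exp (- a) * a ^ k / fact k))
          (inv_L2 (normal_law a) (poisson_law a) \<Phi> F))"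

end

theory Submission
  imports Defs "HOL-Computational_Algebra.Polynomial"
begin

text \<open>
  Write \<open>e\<^sub>t\<close> for the function \<open>exp (t x - a t\<^sup>2 / 2)\<close> on the line and \<open>E\<^sub>t\<close> for
  \<open>exp (- a t) (1 + t) ^ k\<close> on the naturals. Pairing \<open>f \<in> L\<^sup>2(P\<^sub>a)\<close> with \<open>E\<^sub>t\<close> gives, up to the factor
  \<open>exp (- a t)\<close>, a power series in \<open>1 + t\<close> with coefficients \<open>f k exp (- a) a ^ k / k!\<close>, so \<open>f\<close> is determined
  by these pairings. If \<open>\<Phi> e\<^sub>t = E\<^sub>t\<close> for all \<open>t\<close>, then unitarity turns the pairing of \<open>\<Phi> g\<close> with \<open>E\<^sub>t\<close> into
  a Gaussian integral of \<open>g e\<^sub>t\<close>. For \<open>g\<close> the \<open>n\<close>-th Hermite polynomial this integral is \<open>(a t) ^ n\<close>, which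
  is also the pairing of the \<open>n\<close>-th Charlier polynomial with \<open>E\<^sub>t\<close>; for \<open>g\<close> the claimed kernel at \<open>k\<close> it is
  \<open>exp (- a t) (1 + t) ^ k\<close>, so \<open>\<Phi>\<close> maps the kernel at \<open>k\<close> to the point mass at \<open>k\<close> divided by its weight.
  Partial sums of the kernel expansion are therefore mapped to truncations of \<open>F\<close>, and taking for \<open>F\<close> a point
  mass gives uniqueness. Conversely, if \<open>\<Phi>\<close> maps Hermite to Charlier polynomials, then \<open>\<Phi> e\<^sub>t\<close> and \<open>E\<^sub>t\<close>
  have the same expansion in Charlier polynomials, with no loss of norm.
\<close>

section \<open>Power series\<close>

text \<open>Strong induction: once the lower coefficients vanish, division by x^n at x \<noteq> 0
  leaves a series with sum 0 whose constant term is \<open>a n\<close>.\<close>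

lemma powser_coeffs_zero_real:
  fixes a :: "nat \<Rightarrow> real"
  assumes sums: "\<And>x. (\<lambda>n. a n * x ^ n) sums 0"
  shows "a n = 0"
proof (induction n rule: less_induct)
  case (less n)
  have "(\<lambda>k. a (k + n) * x ^ k) sums 0" if "x \<noteq> 0" for x
  proof -
    have "(\<lambda>k. a (k + n) * x ^ (k + n)) sums (0 - (\<Sum>k<n. a k * x ^ k))"
      using sums[of x] by (rule sums_split_initial_segment)
    then have "(\<lambda>k. a (k + n) * x ^ (k + n)) sums 0"
      using less by simp
    from sums_mult[OF this, of "inverse (x ^ n)"] show ?thesis
      using that by (simp add: power_add field_simps)
  qed
  \<comment> \<open>The shifted series is known only away from 0, so its constant term is recovered
    as a limit at 0.\<close>
  then have "((\<lambda>x. 0) \<longlongrightarrow> a (0 + n)) (at (0::real))"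
    using powser_limit_0_strong[of 1 "\<lambda>k. a (k + n)" "\<lambda>x. 0"] by simp
  from tendsto_unique[OF _ this tendsto_const] show ?case by simp
qed

text \<open>At real points the real and imaginary parts of the coefficient differences form two real
  power series with sum 0.\<close>

lemma powser_real_unique:
  fixes a b :: "nat \<Rightarrow> complex"
  assumes "\<And>x::real. (\<lambda>n. a n * of_real x ^ n) sums f x"
    and "\<And>x::real. (\<lambda>n. b n * of_real x ^ n) sums f x"
  shows "a = b"
proof
  fix n
  have *: "(\<lambda>n. (a n - b n) * of_real (x ^ n)) sums 0" for x :: real
    using sums_diff[OF assms(1)[of x] assms(2)[of x]] by (simp add: algebra_simps)
  have "Re (a n - b n) = 0" "Im (a n - b n) = 0"
    using powser_coeffs_zero_real[of "\<lambda>n. Re (a n - b n)"] sums_Re[OF *]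
      powser_coeffs_zero_real[of "\<lambda>n. Im (a n - b n)"] sums_Im[OF *] by simp_all
  then show "a n = b n" by (simp add: complex_eq_iff)
qed

section \<open>Hermite polynomials and the normal law\<close>

text \<open>The raising operator x - a d/dx applied n times to 1. Formal polynomials make
  differentiation and the recursions purely algebraic; \<open>hermite_var_eq_poly\<close> identifies
  them with \<open>hermite_var\<close>.\<close>

fun hermite_poly :: "real \<Rightarrow> nat \<Rightarrow> real poly" where
  "hermite_poly a 0 = 1"
| "hermite_poly a (Suc n) = pCons 0 (hermite_poly a n) - smult a (pderiv (hermite_poly a n))"

text \<open>Differentiating the recursion produces one extra copy of the polynomial plus the raising
  operator applied to its derivative; by induction the latter is a multiple of the same
  polynomial.\<close>

lemma pderiv_hermite_poly:
  "pderiv (hermite_poly a (Suc n)) = smult (of_nat (Suc n)) (hermite_poly a n)"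
proof (induction n)
  case 0
  show ?case by (simp add: pderiv_pCons)
next
  case (Suc n)
  have "pderiv (hermite_poly a (Suc (Suc n)))
      = hermite_poly a (Suc n) + pCons 0 (pderiv (hermite_poly a (Suc n)))
        - smult a (pderiv (pderiv (hermite_poly a (Suc n))))"
    by (simp only: hermite_poly.simps(2)[of a "Suc n"] pderiv_diff pderiv_pCons pderiv_smult)
  also have "\<dots> = hermite_poly a (Suc n) + smult (of_nat (Suc n)) (hermite_poly a (Suc n))"
    unfolding Suc by (simp add: pderiv_smult smult_diff_right algebra_simps)
  also have "\<dots> = smult (of_nat (Suc (Suc n))) (hermite_poly a (Suc n))"
    by (subst (2) of_nat_Suc) (simp only: smult_add_left smult_1_left)
  finally show ?case .
qed

lemma hermite_poly_rec:
  "hermite_poly a (Suc (Suc n))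
     = pCons 0 (hermite_poly a (Suc n)) - smult (a * of_nat (Suc n)) (hermite_poly a n)"
  by (simp only: hermite_poly.simps(2)[of a "Suc n"] pderiv_hermite_poly smult_smult)

text \<open>The three-term recurrence contains no derivative, so it can be rescaled term by term and
  the two sides agree by a two-step induction.\<close>

lemma hermite_poly_scale:
  "s \<noteq> 0 \<Longrightarrow> s ^ n * poly (hermite_poly 1 n) (x / s) = poly (hermite_poly (s\<^sup>2) n) x"
proof (induction n rule: induct_nat_012)
  case (ge2 n)
  have "s ^ Suc (Suc n) * poly (hermite_poly 1 (Suc (Suc n))) (x / s)
      = x * (s ^ Suc n * poly (hermite_poly 1 (Suc n)) (x / s))
        - s\<^sup>2 * real (Suc n) * (s ^ n * poly (hermite_poly 1 n) (x / s))"
    unfolding hermite_poly_rec using \<open>s \<noteq> 0\<close>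
    by (simp add: field_simps power2_eq_square del: hermite_poly.simps)
  then show ?case
    unfolding ge2.IH(1)[OF ge2.prems] ge2.IH(2)[OF ge2.prems]
    by (simp add: hermite_poly_rec del: hermite_poly.simps)
qed simp_all

text \<open>The derivative of P exp(-x^2/2) is -(x P - P') exp(-x^2/2): each differentiation applies
  the raising operator for a = 1 and contributes one sign.\<close>

lemma funpow_deriv_gauss:
  "(deriv ^^ n) (\<lambda>y. exp (- y\<^sup>2 / 2))
     = (\<lambda>x. (-1) ^ n * poly (hermite_poly 1 n) x * exp (- x\<^sup>2 / 2))"
proof (induction n)
  case (Suc n)
  show ?case
    unfolding funpow.simps o_apply Suc
    by (intro ext DERIV_imp_deriv)
       (auto intro!: derivative_eq_intros poly_DERIV simp: algebra_simps)
qed simp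

lemma hermite_eq_poly: "hermite n x = poly (hermite_poly 1 n) x"
proof -
  have "hermite n x = ((-1) ^ n * (-1) ^ n) * (exp (x\<^sup>2 / 2) * exp (- x\<^sup>2 / 2)) * poly (hermite_poly 1 n) x"
    unfolding hermite_def funpow_deriv_gauss by (simp add: algebra_simps)
  then show ?thesis
    by (simp flip: power_mult_distrib exp_add)
qed

lemma hermite_var_eq_poly:
  assumes "a > 0"
  shows "hermite_var a n x = poly (hermite_poly a n) x"
proof -
  have "a powr (real n / 2) = sqrt a ^ n"
    using assms by (simp add: powr_half_sqrt[symmetric] powr_realpow[symmetric] powr_powr)
  then show ?thesis
    using hermite_poly_scale[of "sqrt a" n x] assms by (simp add: hermite_var_def hermite_eq_poly)
qed

section \<open>Gaussian integrals: exponential tilts, moments and orthogonality\<close>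

lemma integrable_normal_law_iff:
  fixes f :: "real \<Rightarrow> real"
  assumes "f \<in> borel_measurable borel"
  shows "integrable (normal_law a) f \<longleftrightarrow> integrable lborel (\<lambda>x. normal_density 0 (sqrt a) x * f x)"
  using assms unfolding normal_law_def by (subst integrable_density) auto

lemma integral_normal_law:
  fixes f :: "real \<Rightarrow> real"
  assumes "f \<in> borel_measurable borel"
  shows "(LINT x|normal_law a. f x) = (LINT x|lborel. normal_density 0 (sqrt a) x * f x)"
  using assms unfolding normal_law_def by (subst integral_density) auto

text \<open>Recentring P at \<mu> turns it into a combination of powers of x - \<mu>, whose
  integrals are the central moments.\<close>

lemma integrable_normal_density_poly:
  assumes "\<sigma> > 0"
  shows "integrable lborel (\<lambda>x. normal_density \<mu> \<sigma> x * poly P x)"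
proof -
  define Q where "Q = pcompose P [:\<mu>, 1:]"
  have "poly P x = (\<Sum>i\<le>degree Q. coeff Q i * (x - \<mu>) ^ i)" for x
    by (simp add: Q_def poly_pcompose flip: poly_altdef)
  then have "normal_density \<mu> \<sigma> x * poly P x
      = (\<Sum>i\<le>degree Q. coeff Q i * (normal_density \<mu> \<sigma> x * (x - \<mu>) ^ i))" for x
    by (simp add: sum_distrib_left mult.left_commute)
  then show ?thesis
    using integrable_normal_moment[OF assms] by simp
qed

text \<open>Completing the square: tilting the centred Gaussian by an exponential moves its mean to
  \<open>a * c\<close>.\<close>

lemma normal_density_mult_exp:
  assumes "a > 0"
  shows "normal_density 0 (sqrt a) x * exp (c * x) = exp (a * c\<^sup>2 / 2) * normal_density (a * c) (sqrt a) x"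
proof -
  have "- x\<^sup>2 / (2 * a) + c * x = a * c\<^sup>2 / 2 - (x - a * c)\<^sup>2 / (2 * a)"
    using assms by (simp add: field_simps power2_eq_square)
  then show ?thesis
    using assms by (simp add: normal_density_def exp_add[symmetric] exp_diff exp_minus divide_simps)
qed

lemma integrable_normal_law_exp_poly:
  assumes "a > 0"
  shows "integrable (normal_law a) (\<lambda>x. exp (c * x) * poly P x)"
proof -
  have eq: "normal_density 0 (sqrt a) x * (exp (c * x) * poly P x)
      = exp (a * c\<^sup>2 / 2) * (normal_density (a * c) (sqrt a) x * poly P x)" for x
    using normal_density_mult_exp[OF assms, of x c] by (simp add: mult.assoc[symmetric])
  show ?thesis
    using assms by (subst integrable_normal_law_iff)
      (auto intro!: integrable_normal_density_poly borel_measurable_continuous_onI continuous_intros simp: eq)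
qed

text \<open>The tilt moves the mean by \<open>a * c\<close>; translating the variable back moves the
  shift into the argument of P.\<close>

lemma integral_normal_law_exp_poly:
  assumes "a > 0"
  shows "(LINT x|normal_law a. exp (c * x) * poly P x)
    = exp (a * c\<^sup>2 / 2) * (LINT x|normal_law a. poly P (x + a * c))"
proof -
  have eq: "normal_density 0 (sqrt a) x * (exp (c * x) * poly P x)
      = exp (a * c\<^sup>2 / 2) * (normal_density (a * c) (sqrt a) x * poly P x)" for x
    using normal_density_mult_exp[OF assms, of x c] by (simp add: mult.assoc[symmetric])
  have "(LINT x|normal_law a. exp (c * x) * poly P x)
      = exp (a * c\<^sup>2 / 2) * (LINT x|lborel. normal_density (a * c) (sqrt a) x * poly P x)"
    by (subst integral_normal_law)
      (auto intro!: borel_measurable_continuous_onI continuous_intros simp: eq)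
  also have "(LINT x|lborel. normal_density (a * c) (sqrt a) x * poly P x)
      = (LINT x|lborel. normal_density (a * c) (sqrt a) (a * c + 1 * x) * poly P (a * c + 1 * x))"
    by (subst lborel_integral_real_affine[where c = 1 and t = "a * c"]) auto
  also have "\<dots> = (LINT x|normal_law a. poly P (x + a * c))"
    by (subst integral_normal_law)
      (auto intro!: borel_measurable_continuous_onI continuous_intros
            simp: normal_density_def add.commute)
  finally show ?thesis .
qed

lemma integrable_normal_law_poly:
  "a > 0 \<Longrightarrow> integrable (normal_law a) (poly P)"
  using integrable_normal_law_exp_poly[of a 0 P] by simp

lemma integrable_normal_law_mult_poly:
  assumes "a > 0"
  shows "integrable (normal_law a) (\<lambda>x. x * poly P x)"
proof -
  have "(\<lambda>x. x * poly P x) = poly (pCons 0 P)" by auto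
  then show ?thesis using integrable_normal_law_poly[OF assms] by simp
qed

lemma integral_normal_law_const: "a > 0 \<Longrightarrow> (LINT x|normal_law a. (c::real)) = c"
  by (subst integral_normal_law) auto

text \<open>This is Gaussian integration by parts for monomials, read off from the explicit moments.
  At n = 0 the truncated n - 1 sits behind the factor n = 0.\<close>

lemma normal_law_moment_rec:
  assumes "a > 0"
  shows "(LINT x|normal_law a. x ^ Suc n) = a * n * (LINT x|normal_law a. x ^ (n - 1))"
proof -
  have even: "(LINT x|normal_law a. x ^ (2 * k)) = fact (2 * k) / ((2 / a) ^ k * fact k)"
    and odd: "(LINT x|normal_law a. x ^ Suc (2 * k)) = 0" for k
    using integral_normal_moment_even[of "sqrt a" 0 k] integral_normal_moment_odd[of "sqrt a" 0 k] assms
    by (simp_all add: integral_normal_law)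
  show ?thesis
  \<comment> \<open>For even n both sides are zero; for odd n the quotient of successive even
    moments supplies the factor \<open>a * n\<close>.\<close>
  proof (cases "even n")
    case True
    then obtain k where n: "n = 2 * k" by blast
    show ?thesis
    proof (cases k)
      case (Suc j)
      then have "n - 1 = Suc (2 * j)" using n by simp
      then show ?thesis using odd[of k] odd[of j] n by (simp only: mult_zero_right)
    qed (use odd[of 0] n in simp)
  next
    case False
    then obtain k where n: "n = Suc (2 * k)" by (auto elim: oddE)
    have "Suc n = 2 * Suc k" "n - 1 = 2 * k" using n by simp_all
    note n_eqs = this
    have fact_eqs: "(fact (2 * Suc k) :: real) = 2 * real (Suc k) * real n * fact (2 * k)"
      "(fact (Suc k) :: real) = real (Suc k) * fact k"
      by (simp_all add: n algebra_simps)
    have "(LINT x|normal_law a. x ^ Suc n) = fact (2 * Suc k) / ((2 / a) ^ Suc k * fact (Suc k))"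
      unfolding n_eqs by (rule even)
    also have "\<dots> = a * n * (fact (2 * k) / ((2 / a) ^ k * fact k))"
      unfolding fact_eqs using assms by (simp add: divide_simps del: fact_Suc of_nat_Suc)
    also have "fact (2 * k) / ((2 / a) ^ k * fact k) = (LINT x|normal_law a. x ^ (n - 1))"
      unfolding n_eqs by (rule even[symmetric])
    finally show ?thesis .
  qed
qed

text \<open>Stein's identity. Both sides are linear in P, and for monomials it is the moment
  recursion.\<close>

lemma normal_law_stein:
  assumes "a > 0"
  shows "(LINT x|normal_law a. x * poly P x) = a * (LINT x|normal_law a. poly (pderiv P) x)"
proof -
  let ?stein = "\<lambda>P. (LINT x|normal_law a. x * poly P x) = a * (LINT x|normal_law a. poly (pderiv P) x)"
  note int = integrable_normal_law_poly[OF assms] integrable_normal_law_mult_poly[OF assms]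
  have monom: "?stein (monom c n)" for c n
  proof -
    have "(LINT x|normal_law a. x * poly (monom c n) x) = c * (LINT x|normal_law a. x ^ Suc n)"
      by (subst integral_mult_right_zero[symmetric]) (simp add: poly_monom algebra_simps)
    also have "\<dots> = a * (real n * c * (LINT x|normal_law a. x ^ (n - 1)))"
      by (simp only: normal_law_moment_rec[OF assms]) (simp add: algebra_simps)
    also have "real n * c * (LINT x|normal_law a. x ^ (n - 1)) = (LINT x|normal_law a. poly (pderiv (monom c n)) x)"
      unfolding pderiv_monom poly_monom by simp
    finally show ?thesis .
  qed
  have add: "?stein (P + Q)" if "?stein P" "?stein Q" for P Q
    using that by (simp add: ring_distribs pderiv_add int)
  have "?stein (\<Sum>i\<in>I. monom (coeff P i) i)" if "finite I" for I
    using that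
  proof (induction I rule: finite_induct)
    case (insert i I)
    have "?stein (monom (coeff P i) i + (\<Sum>i\<in>I. monom (coeff P i) i))"
      using monom insert.IH by (rule add)
    then show ?case using insert.hyps by simp
  qed simp
  from this[of "{..degree P}"] show ?thesis
    by (simp only: finite_atMost poly_as_sum_of_monoms)
qed

text \<open>The raising operator is \<open>a\<close> times the adjoint of differentiation: Stein's
  identity is applied to the product of the Hermite polynomial and Q, and the term in which the
  derivative hits the Hermite polynomial cancels.\<close>

lemma normal_law_hermite_mult:
  assumes "a > 0"
  shows "(LINT x|normal_law a. poly (hermite_poly a (Suc n)) x * poly Q x)
    = a * (LINT x|normal_law a. poly (hermite_poly a n) x * poly (pderiv Q) x)"
proof -
  define G where "G = hermite_poly a n * Q"
  define G' where "G' = pderiv (hermite_poly a n) * Q"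
  note int = integrable_normal_law_poly[OF assms] integrable_normal_law_mult_poly[OF assms]
  have "(LINT x|normal_law a. poly (hermite_poly a (Suc n)) x * poly Q x)
      = (LINT x|normal_law a. x * poly G x - a * poly G' x)"
    by (simp add: G_def G'_def algebra_simps)
  also have "\<dots> = a * ((LINT x|normal_law a. poly (pderiv G) x) - (LINT x|normal_law a. poly G' x))"
    by (simp add: int normal_law_stein[OF assms] algebra_simps)
  also have "\<dots> = a * (LINT x|normal_law a. poly (pderiv G) x - poly G' x)"
    by (simp add: int)
  also have "\<dots> = a * (LINT x|normal_law a. poly (hermite_poly a n) x * poly (pderiv Q) x)"
    by (simp add: G_def G'_def pderiv_mult algebra_simps)
  finally show ?thesis .
qed

text \<open>Moving one raising operator to the other factor lowers both indices by one and yields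
  \<open>a\<close> times the second index. The process ends when an index reaches 0, where a Hermite
  polynomial of positive index integrates to 0.\<close>

lemma normal_law_hermite_orthogonal:
  assumes "a > 0"
  shows "(LINT x|normal_law a. poly (hermite_poly a n) x * poly (hermite_poly a m) x)
    = (if n = m then a ^ n * fact n else 0)"
proof -
  note mult = normal_law_hermite_mult[OF assms]
  have zero: "(LINT x|normal_law a. poly (hermite_poly a (Suc n)) x * poly (hermite_poly a 0) x) = 0" for n
    unfolding mult by simp
  show ?thesis
  proof (induction n arbitrary: m)
    case 0
    show ?case
      using zero[of "m - 1"] integral_normal_law_const[OF assms, of 1]
      by (cases m) (simp_all add: mult.commute)
  next
    case (Suc n)
    show ?case
    proof (cases m)
      case (Suc k)
      have "(LINT x|normal_law a. poly (hermite_poly a (Suc n)) x * poly (hermite_poly a m) x)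
          = a * (real (Suc k) * (LINT x|normal_law a. poly (hermite_poly a n) x * poly (hermite_poly a k) x))"
        unfolding mult Suc pderiv_hermite_poly
        by (subst (2) integral_mult_right_zero[symmetric]) (simp add: algebra_simps)
      then show ?thesis unfolding Suc.IH using Suc by simp
    qed (use zero[of n] in simp)
  qed
qed

text \<open>In the recursion the factor x + c splits: the part x cancels against the derivative term
  by Stein's identity, and c remains as a factor.\<close>

lemma normal_law_hermite_shift:
  assumes "a > 0"
  shows "(LINT x|normal_law a. poly (hermite_poly a n) (x + c)) = c ^ n"
proof (induction n)
  case 0
  show ?case using integral_normal_law_const[OF assms, of 1] by simp
next
  case (Suc n)
  define G where "G = pcompose (hermite_poly a n) [:c, 1:]"
  have G: "poly (hermite_poly a n) (x + c) = poly G x"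
    "poly (pderiv (hermite_poly a n)) (x + c) = poly (pderiv G) x" for x
    by (simp_all add: G_def poly_pcompose pderiv_pcompose pderiv_pCons add.commute)
  note int = integrable_normal_law_poly[OF assms] integrable_normal_law_mult_poly[OF assms]
  have "(LINT x|normal_law a. poly (hermite_poly a (Suc n)) (x + c))
      = (LINT x|normal_law a. (x * poly G x - a * poly (pderiv G) x) + c * poly G x)"
    by (simp add: G algebra_simps)
  also have "\<dots> = c ^ Suc n"
    using Suc by (simp add: int normal_law_stein[OF assms] G)
  finally show ?case .
qed

section \<open>Square-integrable functions\<close>

lemma L2_borel_measurable: "f \<in> L2 M \<Longrightarrow> f \<in> borel_measurable M"
  and L2_integrable_norm_sq: "f \<in> L2 M \<Longrightarrow> integrable M (\<lambda>x. (cmod (f x))\<^sup>2)"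
  by (simp_all add: L2_def)

lemma L2_integrable_inner:
  assumes "f \<in> L2 M" "g \<in> L2 M"
  shows "integrable M (\<lambda>x. f x * cnj (g x))"
proof (rule Bochner_Integration.integrable_bound)
  show "integrable M (\<lambda>x. (cmod (f x))\<^sup>2 + (cmod (g x))\<^sup>2)"
    using assms by (simp add: L2_integrable_norm_sq)
  have "cnj \<in> borel_measurable borel"
    by (intro borel_measurable_continuous_onI continuous_intros)
  from measurable_compose[OF L2_borel_measurable[OF assms(2)] this]
  show "(\<lambda>x. f x * cnj (g x)) \<in> borel_measurable M"
    using L2_borel_measurable[OF assms(1)] by simp
  have "cmod (f x) * cmod (g x) \<le> (cmod (f x))\<^sup>2 + (cmod (g x))\<^sup>2" for x
    using sum_squares_bound[of "cmod (f x)" "cmod (g x)"]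
      mult_nonneg_nonneg[OF norm_ge_zero norm_ge_zero, of "f x" "g x"] by linarith
  then show "AE x in M. norm (f x * cnj (g x)) \<le> norm ((cmod (f x))\<^sup>2 + (cmod (g x))\<^sup>2)"
    by (simp add: norm_mult)
qed

lemma L2_lincomb:
  assumes "f \<in> L2 M" "g \<in> L2 M"
  shows "(\<lambda>x. c * f x + d * g x) \<in> L2 M"
proof -
  have meas: "(\<lambda>x. c * f x + d * g x) \<in> borel_measurable M"
    using assms[THEN L2_borel_measurable] by simp
  have "integrable M (\<lambda>x. (cmod (c * f x + d * g x))\<^sup>2)"
  proof (rule Bochner_Integration.integrable_bound)
    show "integrable M (\<lambda>x. 2 * (cmod c)\<^sup>2 * (cmod (f x))\<^sup>2 + 2 * (cmod d)\<^sup>2 * (cmod (g x))\<^sup>2)"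
      using assms by (simp add: L2_integrable_norm_sq)
    show "(\<lambda>x. (cmod (c * f x + d * g x))\<^sup>2) \<in> borel_measurable M"
      using meas by simp
    have "(cmod (c * f x + d * g x))\<^sup>2 \<le> 2 * (cmod c)\<^sup>2 * (cmod (f x))\<^sup>2 + 2 * (cmod d)\<^sup>2 * (cmod (g x))\<^sup>2" for x
    proof -
      have "(cmod (c * f x + d * g x))\<^sup>2 \<le> (cmod (c * f x) + cmod (d * g x))\<^sup>2"
        by (intro power_mono norm_triangle_ineq) simp
      also have "\<dots> \<le> 2 * (cmod (c * f x))\<^sup>2 + 2 * (cmod (d * g x))\<^sup>2"
        using sum_squares_bound[of "cmod (c * f x)" "cmod (d * g x)"] by (simp add: power2_sum)
      finally show ?thesis by (simp add: norm_mult power_mult_distrib)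
    qed
    then show "AE x in M. norm ((cmod (c * f x + d * g x))\<^sup>2)
        \<le> norm (2 * (cmod c)\<^sup>2 * (cmod (f x))\<^sup>2 + 2 * (cmod d)\<^sup>2 * (cmod (g x))\<^sup>2)"
      by simp
  qed
  with meas show ?thesis by (simp add: L2_def)
qed

lemma L2_diff: "f \<in> L2 M \<Longrightarrow> g \<in> L2 M \<Longrightarrow> (\<lambda>x. f x - g x) \<in> L2 M"
  using L2_lincomb[of f M g 1 "-1"] by simp

lemma L2_zero: "(\<lambda>x. 0) \<in> L2 M"
  by (simp add: L2_def)

lemma inner_L2_lincomb_left:
  assumes "f \<in> L2 M" "g \<in> L2 M" "h \<in> L2 M"
  shows "inner_L2 M (\<lambda>x. c * f x + d * g x) h = c * inner_L2 M f h + d * inner_L2 M g h"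
  unfolding inner_L2_def
  using L2_integrable_inner[OF assms(1,3)] L2_integrable_inner[OF assms(2,3)]
  by (simp add: ring_distribs mult.assoc)

lemma inner_L2_commute: "inner_L2 M g f = cnj (inner_L2 M f g)"
  unfolding inner_L2_def by (subst Bochner_Integration.integral_cnj[symmetric]) (simp add: mult.commute)

lemma inner_L2_lincomb_right:
  assumes "f \<in> L2 M" "g \<in> L2 M" "h \<in> L2 M"
  shows "inner_L2 M h (\<lambda>x. c * f x + d * g x) = cnj c * inner_L2 M h f + cnj d * inner_L2 M h g"
  using assms by (simp add: inner_L2_commute[of M h] inner_L2_lincomb_left)

lemma norm_L2_eq_inner: "norm_L2 M f = sqrt (Re (inner_L2 M f f))"
proof -
  have "inner_L2 M f f = of_real (LINT x|M. (cmod (f x))\<^sup>2)"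
    by (simp add: inner_L2_def complex_norm_square[symmetric] flip: integral_complex_of_real)
  then show ?thesis by (simp add: norm_L2_def)
qed

lemma norm_L2_zero_imp_ae_eq:
  assumes "f \<in> L2 M" "g \<in> L2 M" "norm_L2 M (\<lambda>x. f x - g x) = 0"
  shows "ae_eq M f g"
proof -
  have "AE x in M. (cmod (f x - g x))\<^sup>2 = 0"
    using assms integral_nonneg_eq_0_iff_AE[OF L2_integrable_norm_sq[OF L2_diff[OF assms(1,2)]]]
    by (simp add: norm_L2_def)
  then show ?thesis by (simp add: ae_eq_def)
qed

lemma L2_of_real_iff:
  "(\<lambda>x. complex_of_real (f x)) \<in> L2 M \<longleftrightarrow> f \<in> borel_measurable M \<and> integrable M (\<lambda>x. (f x)\<^sup>2)"
proof -
  have "(\<lambda>x. complex_of_real (f x)) \<in> borel_measurable M \<longleftrightarrow> f \<in> borel_measurable M"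
  proof
    assume "(\<lambda>x. complex_of_real (f x)) \<in> borel_measurable M"
    from measurable_compose[OF this borel_measurable_Re] show "f \<in> borel_measurable M"
      by simp
  qed simp
  then show ?thesis by (simp add: L2_def)
qed

lemma inner_L2_of_real:
  "inner_L2 M (\<lambda>x. complex_of_real (f x)) (\<lambda>x. complex_of_real (g x)) = of_real (LINT x|M. f x * g x)"
  by (simp add: inner_L2_def flip: integral_complex_of_real)

text \<open>Squaring preserves the form exponential times polynomial, so integrability of that form
  suffices.\<close>

lemma exp_poly_L2:
  assumes "a > 0"
  shows "(\<lambda>x. complex_of_real (exp (c * x) * poly P x)) \<in> L2 (normal_law a)"
proof -
  have eq: "(\<lambda>x. (exp (c * x) * poly P x)\<^sup>2) = (\<lambda>x. exp ((2 * c) * x) * poly (P * P) x)"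
    by (simp add: power_mult_distrib mult.assoc power2_eq_square[of "poly P _"] flip: exp_double)
  have "integrable (normal_law a) (\<lambda>x. (exp (c * x) * poly P x)\<^sup>2)"
    unfolding eq by (rule integrable_normal_law_exp_poly[OF assms])
  moreover have "(\<lambda>x. exp (c * x) * poly P x) \<in> borel_measurable (normal_law a)"
    by (auto simp: normal_law_def intro!: borel_measurable_continuous_onI continuous_intros)
  ultimately show ?thesis
    unfolding L2_of_real_iff by (rule conjI[rotated])
qed

section \<open>Charlier polynomials and the Poisson law\<close>

text \<open>Every natural number has positive mass, so the only null set is empty and
  almost-everywhere statements become pointwise ones.\<close>

lemma AE_poisson_law_iff: "a > 0 \<Longrightarrow> (AE k in poisson_law a. P k) \<longleftrightarrow> (\<forall>k. P k)"
  by (simp only: poisson_law_def AE_measure_pmf_iff set_pmf_poisson) simp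

lemma ae_eq_poisson_law: "a > 0 \<Longrightarrow> ae_eq (poisson_law a) f g \<longleftrightarrow> f = g"
  by (simp add: ae_eq_def AE_poisson_law_iff fun_eq_iff)

lemma poisson_law_eq_density:
  assumes "a > 0"
  shows "poisson_law a = density (count_space UNIV) (\<lambda>k. ennreal (exp (- a) * a ^ k / fact k))"
proof -
  have "pmf (poisson_pmf a) = (\<lambda>k. exp (- a) * a ^ k / fact k)"
    using assms by (simp add: fun_eq_iff)
  then show ?thesis by (simp only: poisson_law_def measure_pmf_eq_density)
qed

lemma integrable_poisson_law_iff:
  fixes f :: "nat \<Rightarrow> 'a :: {banach, second_countable_topology}"
  assumes "a > 0"
  shows "integrable (poisson_law a) f \<longleftrightarrow> summable (\<lambda>k. exp (- a) * a ^ k / fact k * norm (f k))"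
proof -
  have "norm ((exp (- a) * a ^ k / fact k) *\<^sub>R f k) = exp (- a) * a ^ k / fact k * norm (f k)" for k
    using assms by simp
  then show ?thesis
    unfolding poisson_law_eq_density[OF assms]
    using assms by (subst integrable_density) (simp_all add: integrable_count_space_nat_iff)
qed

lemma integral_poisson_law_sums:
  fixes f :: "nat \<Rightarrow> 'a :: {banach, second_countable_topology}"
  assumes "a > 0" "integrable (poisson_law a) f"
  shows "(\<lambda>k. (exp (- a) * a ^ k / fact k) *\<^sub>R f k) sums (LINT k|poisson_law a. f k)"
proof -
  have "integrable (count_space UNIV) (\<lambda>k. (exp (- a) * a ^ k / fact k) *\<^sub>R f k)"
    using assms(2) unfolding poisson_law_eq_density[OF assms(1)]
    by (subst (asm) integrable_density) (use assms(1) in simp_all)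
  from sums_integral_count_space_nat[OF this]
  have "(\<lambda>k. (exp (- a) * a ^ k / fact k) *\<^sub>R f k)
      sums (LINT k|count_space UNIV. (exp (- a) * a ^ k / fact k) *\<^sub>R f k)" .
  moreover have "(LINT k|poisson_law a. f k)
      = (LINT k|count_space UNIV. (exp (- a) * a ^ k / fact k) *\<^sub>R f k)"
    unfolding poisson_law_eq_density[OF assms(1)]
    by (subst integral_density) (use assms(1) in simp_all)
  ultimately show ?thesis by simp
qed

section \<open>Poisson generating functions and uniqueness from pairings\<close>

lemma poisson_law_pgf_sums:
  "(\<lambda>k. exp (- a) * a ^ k / fact k * s ^ k) sums exp (a * (s - 1))" for a s :: real
proof -
  have "(\<lambda>k. exp (- a) * ((a * s) ^ k /\<^sub>R fact k)) sums (exp (- a) * exp (a * s))"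
    by (intro sums_mult exp_converges)
  moreover have "exp (- a) * ((a * s) ^ k /\<^sub>R fact k) = exp (- a) * a ^ k / fact k * s ^ k" for k
    by (simp add: power_mult_distrib divide_inverse)
  moreover have "exp (- a) * exp (a * s) = exp (a * (s - 1))"
    by (simp add: right_diff_distrib flip: exp_add)
  ultimately show ?thesis by simp
qed

lemma poisson_exp_L2:
  assumes "a > 0"
  shows "(\<lambda>k. complex_of_real (exp (- a * t) * (1 + t) ^ k)) \<in> L2 (poisson_law a)"
proof -
  have eq: "(\<lambda>k. (exp (- a * t) * (1 + t) ^ k)\<^sup>2) = (\<lambda>k. (exp (- a * t))\<^sup>2 * ((1 + t)\<^sup>2) ^ k)"
    by (simp only: power_mult_distrib power_mult[symmetric] mult.commute[of 2])
  have "integrable (poisson_law a) (\<lambda>k. ((1 + t)\<^sup>2) ^ k)"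
    using sums_summable[OF poisson_law_pgf_sums[of a "(1 + t)\<^sup>2"]] assms
    by (simp add: integrable_poisson_law_iff)
  then have "integrable (poisson_law a) (\<lambda>k. (exp (- a * t) * (1 + t) ^ k)\<^sup>2)"
    unfolding eq by (rule integrable_mult_right)
  moreover have "(\<lambda>k. exp (- a * t) * (1 + t) ^ k) \<in> borel_measurable (poisson_law a)"
    by (simp add: poisson_law_def)
  ultimately show ?thesis
    unfolding L2_of_real_iff by (rule conjI[rotated])
qed

text \<open>The factor exp(a t) cancels the normalisation of the paired function, which leaves a
  power series in 1 + t.\<close>

lemma inner_poisson_exp_sums:
  assumes "a > 0" "f \<in> L2 (poisson_law a)"
  shows "(\<lambda>k. f k * of_real (exp (- a) * a ^ k / fact k) * of_real (1 + t) ^ k) sums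
    (inner_L2 (poisson_law a) f (\<lambda>k. of_real (exp (- a * t) * (1 + t) ^ k)) * of_real (exp (a * t)))"
proof -
  let ?E = "\<lambda>k. complex_of_real (exp (- a * t) * (1 + t) ^ k)"
  have "(exp (- a) * a ^ k / fact k) *\<^sub>R (f k * cnj (?E k)) * of_real (exp (a * t))
      = f k * of_real (exp (- a) * a ^ k / fact k) * of_real (1 + t) ^ k" for k
  proof -
    have cancel: "p * (z * (u * w)) * v = z * p * w" if "u * v = 1" for p z u v w :: complex
    proof -
      have "p * (z * (u * w)) * v = z * p * w * (u * v)" by (simp only: mult_ac)
      then show ?thesis using that by simp
    qed
    have "complex_of_real (exp (- a * t)) * of_real (exp (a * t)) = 1"
      by (simp flip: of_real_mult exp_add)
    from cancel[OF this] show ?thesis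
      by (simp only: scaleR_conv_of_real of_real_mult[of "exp (- a * t)"] of_real_power
        complex_cnj_complex_of_real complex_cnj_mult complex_cnj_power)
  qed
  then show ?thesis
    using sums_mult2[OF integral_poisson_law_sums[OF assms(1)
        L2_integrable_inner[OF assms(2) poisson_exp_L2[OF assms(1), of t]]], of "of_real (exp (a * t))"]
    by (simp only: inner_L2_def)
qed

text \<open>Both weighted sequences are coefficients of the same power series, and the weights are
  nonzero. Since g enters through its series alone, Charlier polynomials and point masses can be
  recognised directly as images under \<Phi>.\<close>

lemma L2_poisson_eqI:
  assumes "a > 0" "f \<in> L2 (poisson_law a)"
    and "\<And>t::real. (\<lambda>k. g k * of_real (exp (- a) * a ^ k / fact k) * of_real (1 + t) ^ k) sums
      (inner_L2 (poisson_law a) f (\<lambda>k. of_real (exp (- a * t) * (1 + t) ^ k)) * of_real (exp (a * t)))"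
  shows "f = g"
proof -
  let ?p = "\<lambda>k. complex_of_real (exp (- a) * a ^ k / fact k)"
  let ?F = "\<lambda>t::real. inner_L2 (poisson_law a) f (\<lambda>k. of_real (exp (- a * t) * (1 + t) ^ k)) * of_real (exp (a * t))"
  \<comment> \<open>The substitution t = s - 1 centres both series at 0.\<close>
  have s_eq: "1 + (s - 1) = s" for s :: real by simp
  have "(\<lambda>k. f k * ?p k) = (\<lambda>k. g k * ?p k)"
  proof (rule powser_real_unique)
    show "(\<lambda>k. f k * ?p k * of_real s ^ k) sums ?F (s - 1)" for s :: real
      using inner_poisson_exp_sums[OF assms(1,2), of "s - 1"] unfolding s_eq .
    show "(\<lambda>k. g k * ?p k * of_real s ^ k) sums ?F (s - 1)" for s :: real
      using assms(3)[of "s - 1"] unfolding s_eq .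
  qed
  moreover have "?p k \<noteq> 0" for k using assms(1) by simp
  ultimately have "f k = g k" for k
    using fun_cong[of "\<lambda>k. f k * ?p k" "\<lambda>k. g k * ?p k" k] by (simp only: mult_right_cancel simp_thms)
  then show ?thesis by (rule ext)
qed

text \<open>The falling factorial of k vanishes for k < j; for k = i + j it cancels against k! and
  leaves (a s)^j times the generating function.\<close>

lemma poisson_law_factorial_moment_sums:
  fixes a s :: real
  shows "(\<lambda>k. (real k gchoose j) * fact j * (exp (- a) * a ^ k / fact k) * s ^ k)
    sums ((a * s) ^ j * exp (a * (s - 1)))"
proof -
  let ?f = "\<lambda>k. (real k gchoose j) * fact j * (exp (- a) * a ^ k / fact k) * s ^ k"
  have "?f (i + j) = (a * s) ^ j * (exp (- a) * a ^ i / fact i * s ^ i)" for i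
    by (simp add: binomial_gbinomial[symmetric] binomial_fact power_add power_mult_distrib field_simps
        flip: of_nat_add)
  then have "(\<lambda>i. ?f (i + j)) sums ((a * s) ^ j * exp (a * (s - 1)))"
    using sums_mult[OF poisson_law_pgf_sums] by simp
  moreover have "?f i = 0" if "i < j" for i
    using that by (simp add: binomial_gbinomial[symmetric])
  ultimately show ?thesis
    using sums_zero_iff_shift[of j ?f] by blast
qed

text \<open>The factorial moments are summed with the Charlier coefficients; the binomial theorem
  assembles the powers of s into (s - 1)^n.\<close>

lemma charlier_poisson_sums:
  assumes "a > 0"
  shows "(\<lambda>k. charlier a n (real k) * (exp (- a) * a ^ k / fact k) * s ^ k)
    sums ((a * (s - 1)) ^ n * exp (a * (s - 1)))"
proof -
  let ?c = "\<lambda>j. a ^ n * ((-1) ^ (n - j) * real (n choose j) * inverse (a ^ j))"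
  have "(\<lambda>k. \<Sum>j=0..n. ?c j * ((real k gchoose j) * fact j * (exp (- a) * a ^ k / fact k) * s ^ k))
      sums (\<Sum>j=0..n. ?c j * ((a * s) ^ j * exp (a * (s - 1))))"
    by (intro sums_sum sums_mult poisson_law_factorial_moment_sums)
  moreover have "(\<Sum>j=0..n. ?c j * ((real k gchoose j) * fact j * (exp (- a) * a ^ k / fact k) * s ^ k))
      = charlier a n (real k) * (exp (- a) * a ^ k / fact k) * s ^ k" for k
    unfolding charlier_def sum_distrib_left sum_distrib_right by (intro sum.cong) (simp_all add: mult_ac)
  moreover have "(\<Sum>j=0..n. ?c j * ((a * s) ^ j * exp (a * (s - 1))))
      = a ^ n * (s + (-1)) ^ n * exp (a * (s - 1))"
    unfolding binomial_ring sum_distrib_left sum_distrib_right atLeast0AtMost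
    using assms by (intro sum.cong) (simp_all add: power_mult_distrib field_simps)
  ultimately show ?thesis
    by (simp add: power_mult_distrib)
qed

section \<open>Orthogonal expansions and limits in the Poisson space\<close>

text \<open>
  Each subtraction of a term removes from \<open>e\<close> exactly its component along \<open>h m\<close>, so the
  squared norm of the residual is the tail of the exponential series of \<open>a * t\<^sup>2\<close>.
\<close>

lemma L2_exponential_expansion:
  fixes a t :: real
  assumes h: "\<And>n. h n \<in> L2 M"
    and orth: "\<And>n m. inner_L2 M (h n) (h m) = (if n = m then of_real (a ^ n * fact n) else 0)"
    and e: "e \<in> L2 M" and e_h: "\<And>n. inner_L2 M e (h n) = of_real ((a * t) ^ n)"
    and e_e: "inner_L2 M e e = of_real (exp (a * t\<^sup>2))"
  shows "L2_converges M (\<lambda>m x. \<Sum>n<m. of_real (t ^ n / fact n) * h n x) e"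
proof -
  define r where "r m x = e x - (\<Sum>n<m. of_real (t ^ n / fact n) * h n x)" for m x
  have r_Suc: "r (Suc m) = (\<lambda>x. 1 * r m x + of_real (- (t ^ m / fact m)) * h m x)" for m
    by (simp add: r_def fun_eq_iff)
  have r: "r m \<in> L2 M \<and>
      (\<forall>n. inner_L2 M (r m) (h n) = (if n < m then 0 else of_real ((a * t) ^ n))) \<and>
      inner_L2 M (r m) (r m) = of_real (exp (a * t\<^sup>2) - (\<Sum>n<m. (a * t\<^sup>2) ^ n / fact n))" for m
  proof (induction m)
    case 0
    have "r 0 = e" by (simp add: r_def fun_eq_iff)
    then show ?case using e e_h e_e by simp
  next
    case (Suc m)
    then have r_L2: "r m \<in> L2 M"
      and r_h: "\<And>n. inner_L2 M (r m) (h n) = (if n < m then 0 else of_real ((a * t) ^ n))"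
      and r_r: "inner_L2 M (r m) (r m) = of_real (exp (a * t\<^sup>2) - (\<Sum>n<m. (a * t\<^sup>2) ^ n / fact n))"
      by auto
    have Suc_L2: "r (Suc m) \<in> L2 M"
      unfolding r_Suc by (intro L2_lincomb r_L2 h)
    have Suc_h: "inner_L2 M (r (Suc m)) (h n) = (if n < Suc m then 0 else of_real ((a * t) ^ n))" for n
      unfolding r_Suc inner_L2_lincomb_left[OF r_L2 h h] r_h orth
      by (auto simp: power_mult_distrib less_Suc_eq mult.commute)
    have "inner_L2 M (r (Suc m)) (r (Suc m))
        = inner_L2 M (r (Suc m)) (\<lambda>x. 1 * r m x + of_real (- (t ^ m / fact m)) * h m x)"
      by (simp only: r_Suc)
    \<comment> \<open>The new residual is orthogonal to \<open>h m\<close>, so in the second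
      argument it may be replaced by the old one.\<close>
    also have "\<dots> = inner_L2 M (r (Suc m)) (r m)"
      by (subst inner_L2_lincomb_right[OF r_L2 h Suc_L2]) (simp add: Suc_h)
    also have "\<dots> = inner_L2 M (r m) (r m) - of_real (t ^ m / fact m) * inner_L2 M (h m) (r m)"
      unfolding r_Suc inner_L2_lincomb_left[OF r_L2 h r_L2] by simp
    also have "inner_L2 M (h m) (r m) = of_real ((a * t) ^ m)"
      by (subst inner_L2_commute) (simp add: r_h)
    also have "complex_of_real (t ^ m / fact m) * of_real ((a * t) ^ m) = of_real ((a * t\<^sup>2) ^ m / fact m)"
      by (simp add: power_mult_distrib power2_eq_square)
    finally have "inner_L2 M (r (Suc m)) (r (Suc m))
        = of_real (exp (a * t\<^sup>2) - (\<Sum>n<Suc m. (a * t\<^sup>2) ^ n / fact n))"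
      unfolding r_r of_real_diff[symmetric] by (simp only: sum.lessThan_Suc diff_diff_eq)
    with Suc_L2 Suc_h show ?case by blast
  qed
  have "(\<lambda>n. (a * t\<^sup>2) ^ n / fact n) sums exp (a * t\<^sup>2)"
    using exp_converges[of "a * t\<^sup>2"] by (simp add: field_simps)
  then have "(\<lambda>m. sqrt (exp (a * t\<^sup>2) - (\<Sum>n<m. (a * t\<^sup>2) ^ n / fact n))) \<longlonglongrightarrow> sqrt (exp (a * t\<^sup>2) - exp (a * t\<^sup>2))"
    by (intro tendsto_intros) (simp add: sums_def)
  moreover have "norm_L2 M (r m) = sqrt (exp (a * t\<^sup>2) - (\<Sum>n<m. (a * t\<^sup>2) ^ n / fact n))" for m
    using r[of m] by (simp only: norm_L2_eq_inner Re_complex_of_real)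
  ultimately have "(\<lambda>m. norm_L2 M (r m)) \<longlonglongrightarrow> 0"
    by simp
  moreover have "(\<lambda>x. \<Sum>n<m. of_real (t ^ n / fact n) * h n x) \<in> L2 M" for m
    using L2_diff[OF e, of "r m"] r[of m] by (simp add: r_def)
  moreover have "norm_L2 M (\<lambda>x. (\<Sum>n<m. of_real (t ^ n / fact n) * h n x) - e x) = norm_L2 M (r m)" for m
    unfolding norm_L2_def r_def by (simp add: norm_minus_commute)
  ultimately show ?thesis
    using e by (simp add: L2_converges_def)
qed

text \<open>The squared norm is a series of nonnegative terms and dominates each of them, so
  evaluation at a point is a bounded functional.\<close>

lemma L2_poisson_pointwise_bound:
  assumes "a > 0" "f \<in> L2 (poisson_law a)"
  shows "sqrt (exp (- a) * a ^ k / fact k) * cmod (f k) \<le> norm_L2 (poisson_law a) f"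
proof -
  have sums: "(\<lambda>k. exp (- a) * a ^ k / fact k * (cmod (f k))\<^sup>2) sums (LINT k|poisson_law a. (cmod (f k))\<^sup>2)"
    using integral_poisson_law_sums[OF assms(1) L2_integrable_norm_sq[OF assms(2)]] by simp
  have "(\<Sum>k\<in>{k}. exp (- a) * a ^ k / fact k * (cmod (f k))\<^sup>2) \<le> (\<Sum>k. exp (- a) * a ^ k / fact k * (cmod (f k))\<^sup>2)"
    using assms(1) sums by (intro sum_le_suminf) (auto simp: sums_iff)
  then have "exp (- a) * a ^ k / fact k * (cmod (f k))\<^sup>2 \<le> (LINT k|poisson_law a. (cmod (f k))\<^sup>2)"
    using sums by (simp add: sums_iff)
  from real_sqrt_le_mono[OF this] show ?thesis
    unfolding norm_L2_def real_sqrt_mult real_sqrt_abs abs_norm_cancel .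
qed

lemma L2_poisson_converges_pointwise:
  assumes "a > 0" "L2_converges (poisson_law a) S f"
  shows "(\<lambda>n. S n k) \<longlonglongrightarrow> f k"
proof -
  define c where "c = sqrt (exp (- a) * a ^ k / fact k)"
  have "c > 0" using assms(1) by (simp add: c_def)
  have S: "S n \<in> L2 (poisson_law a)" "f \<in> L2 (poisson_law a)"
    and lim: "(\<lambda>n. norm_L2 (poisson_law a) (\<lambda>x. S n x - f x)) \<longlonglongrightarrow> 0" for n
    using assms(2) by (auto simp: L2_converges_def)
  have bound: "c * cmod (S n k - f k) \<le> norm_L2 (poisson_law a) (\<lambda>x. S n x - f x)" for n
    unfolding c_def using L2_poisson_pointwise_bound[OF assms(1) L2_diff[OF S]] .
  have "(\<lambda>n. cmod (S n k - f k)) \<longlonglongrightarrow> 0"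
  proof (rule tendsto_0_le)
    show "(\<lambda>n. norm_L2 (poisson_law a) (\<lambda>x. S n x - f x)) \<longlonglongrightarrow> 0" by (rule lim)
    show "\<forall>\<^sub>F n in sequentially. norm (cmod (S n k - f k))
        \<le> norm (norm_L2 (poisson_law a) (\<lambda>x. S n x - f x)) * (1 / c)"
      using bound \<open>c > 0\<close> by (intro always_eventually allI)
        (simp add: pos_le_divide_eq mult.commute, meson abs_ge_self order_trans)
  qed
  then show ?thesis
    by (simp add: tendsto_norm_zero_iff LIM_zero_iff)
qed

text \<open>Dominated convergence with bound |F|^2: at each k the difference is 0 as soon as n >
  k.\<close>

lemma L2_poisson_truncation:
  assumes "F \<in> L2 (poisson_law a)"
  shows "(\<lambda>n. norm_L2 (poisson_law a) (\<lambda>k. (if k < n then F k else 0) - F k)) \<longlonglongrightarrow> 0"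
proof -
  have "(\<lambda>n. LINT k|poisson_law a. (cmod ((if k < n then F k else 0) - F k))\<^sup>2) \<longlonglongrightarrow> (LINT k|poisson_law a. (0::real))"
  proof (rule integral_dominated_convergence)
    show "integrable (poisson_law a) (\<lambda>k. (cmod (F k))\<^sup>2)"
      using assms by (rule L2_integrable_norm_sq)
    show "AE k in poisson_law a. (\<lambda>n. (cmod ((if k < n then F k else 0) - F k))\<^sup>2) \<longlonglongrightarrow> 0"
    proof (intro AE_I2 tendsto_eventually)
      fix k
      show "\<forall>\<^sub>F n in sequentially. (cmod ((if k < n then F k else 0) - F k))\<^sup>2 = 0"
        using eventually_gt_at_top[of k] by eventually_elim simp
    qed
  qed (auto simp: poisson_law_def)
  then show ?thesis
    unfolding norm_L2_def using tendsto_real_sqrt by fastforce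
qed

section \<open>The unitary map and its kernel\<close>

definition inv_kernel :: "real \<Rightarrow> nat \<Rightarrow> real \<Rightarrow> complex" where
  "inv_kernel a k x = of_real (exp (- a / 2 - x) * hermite_var a k (x + 2 * a) / a ^ k)"

context
  fixes a :: real and \<Phi> :: "(real \<Rightarrow> complex) \<Rightarrow> (nat \<Rightarrow> complex)"
  assumes a_pos: "a > 0"
    and unitary: "unitary_L2 (normal_law a) (poisson_law a) \<Phi>"
begin

lemma \<Phi>_L2: "f \<in> L2 (normal_law a) \<Longrightarrow> \<Phi> f \<in> L2 (poisson_law a)"
  and \<Phi>_lincomb: "f \<in> L2 (normal_law a) \<Longrightarrow> g \<in> L2 (normal_law a) \<Longrightarrow>
    \<Phi> (\<lambda>x. c * f x + d * g x) = (\<lambda>k. c * \<Phi> f k + d * \<Phi> g k)"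
  and \<Phi>_inner: "f \<in> L2 (normal_law a) \<Longrightarrow> g \<in> L2 (normal_law a) \<Longrightarrow>
    inner_L2 (poisson_law a) (\<Phi> f) (\<Phi> g) = inner_L2 (normal_law a) f g"
  and \<Phi>_surj: "h \<in> L2 (poisson_law a) \<Longrightarrow> \<exists>f\<in>L2 (normal_law a). \<Phi> f = h"
  using unitary a_pos by (simp_all add: unitary_L2_def ae_eq_poisson_law)

lemma \<Phi>_norm: "f \<in> L2 (normal_law a) \<Longrightarrow> norm_L2 (poisson_law a) (\<Phi> f) = norm_L2 (normal_law a) f"
  by (simp add: norm_L2_eq_inner \<Phi>_inner)

lemma inv_L2_\<Phi>:
  assumes "h \<in> L2 (poisson_law a)"
  shows "inv_L2 (normal_law a) (poisson_law a) \<Phi> h \<in> L2 (normal_law a)"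
    and "\<Phi> (inv_L2 (normal_law a) (poisson_law a) \<Phi> h) = h"
proof -
  have "\<exists>f. f \<in> L2 (normal_law a) \<and> ae_eq (poisson_law a) (\<Phi> f) h"
    using \<Phi>_surj[OF assms] by (auto simp: ae_eq_poisson_law a_pos)
  from someI_ex[OF this, folded inv_L2_def]
  show "inv_L2 (normal_law a) (poisson_law a) \<Phi> h \<in> L2 (normal_law a)"
    and "\<Phi> (inv_L2 (normal_law a) (poisson_law a) \<Phi> h) = h"
    by (simp_all only: ae_eq_poisson_law[OF a_pos])
qed

section \<open>Test functions and their pairings\<close>

abbreviation (input) hermite_fn :: "nat \<Rightarrow> real \<Rightarrow> complex" where
  "hermite_fn n \<equiv> \<lambda>x. of_real (hermite_var a n x)"

abbreviation (input) normal_exp :: "real \<Rightarrow> real \<Rightarrow> complex" where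
  "normal_exp t \<equiv> \<lambda>x. of_real (exp (t * x - a * t\<^sup>2 / 2))"

abbreviation (input) poisson_exp :: "real \<Rightarrow> nat \<Rightarrow> complex" where
  "poisson_exp t \<equiv> \<lambda>k. of_real (exp (- a * t) * (1 + t) ^ k)"

text \<open>Hermite functions, exponentials and kernel functions share the form exp(c x) P(x), with
  c = 0, c = t and c = -1, so one integrability result and one pairing formula serve all
  three.\<close>

lemma hermite_fn_eq: "hermite_fn n = (\<lambda>x. of_real (exp (0 * x) * poly (hermite_poly a n) x))"
  by (simp add: hermite_var_eq_poly a_pos)

lemma normal_exp_eq:
  "normal_exp t = (\<lambda>x. of_real (exp (t * x) * poly [:exp (- (a * t\<^sup>2 / 2)):] x))"
  by (simp flip: of_real_mult exp_add)

lemma inv_kernel_eq: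
  "inv_kernel a k = (\<lambda>x. of_real (exp (- 1 * x)
     * poly (smult (exp (- a / 2) / a ^ k) (pcompose (hermite_poly a k) [:2 * a, 1:])) x))"
proof
  fix x
  have exp_eq: "exp (- a / 2 - x) = exp (- 1 * x) * exp (- a / 2)"
    by (simp flip: exp_add)
  show "inv_kernel a k x = of_real (exp (- 1 * x)
     * poly (smult (exp (- a / 2) / a ^ k) (pcompose (hermite_poly a k) [:2 * a, 1:])) x)"
    unfolding inv_kernel_def exp_eq hermite_var_eq_poly[OF a_pos]
    by (simp add: poly_pcompose add.commute)
qed

lemma hermite_fn_L2: "hermite_fn n \<in> L2 (normal_law a)"
  unfolding hermite_fn_eq by (rule exp_poly_L2[OF a_pos])

lemma normal_exp_L2: "normal_exp t \<in> L2 (normal_law a)"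
  unfolding normal_exp_eq by (rule exp_poly_L2[OF a_pos])

lemma inv_kernel_L2: "inv_kernel a k \<in> L2 (normal_law a)"
  unfolding inv_kernel_eq by (rule exp_poly_L2[OF a_pos])

text \<open>The product is again an exponential times P, now with rate c + t, so the tilt formula
  applies.\<close>

lemma inner_exp_poly_normal_exp:
  "inner_L2 (normal_law a) (\<lambda>x. of_real (exp (c * x) * poly P x)) (normal_exp t)
    = of_real (exp (a * (c + t)\<^sup>2 / 2 - a * t\<^sup>2 / 2) * (LINT x|normal_law a. poly P (x + a * (c + t))))"
proof -
  have "(exp (c * x) * poly P x) * exp (t * x - a * t\<^sup>2 / 2)
      = exp (- (a * t\<^sup>2 / 2)) * (exp ((c + t) * x) * poly P x)" for x
  proof -
    have exp_eq: "exp (c * x) * exp (t * x - a * t\<^sup>2 / 2) = exp (- (a * t\<^sup>2 / 2)) * exp ((c + t) * x)"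
      by (simp add: ring_distribs flip: exp_add)
    have "(exp (c * x) * poly P x) * exp (t * x - a * t\<^sup>2 / 2)
        = (exp (c * x) * exp (t * x - a * t\<^sup>2 / 2)) * poly P x"
      by (simp only: mult_ac)
    then show ?thesis by (simp only: exp_eq mult.assoc)
  qed
  then have "(LINT x|normal_law a. (exp (c * x) * poly P x) * exp (t * x - a * t\<^sup>2 / 2))
      = exp (- (a * t\<^sup>2 / 2)) * (exp (a * (c + t)\<^sup>2 / 2) * (LINT x|normal_law a. poly P (x + a * (c + t))))"
    by (simp only: integral_mult_right_zero integral_normal_law_exp_poly[OF a_pos])
  then show ?thesis
    by (simp only: inner_L2_of_real mult.assoc[symmetric] exp_add[symmetric]) (simp only: uminus_add_conv_diff)
qed

lemma inner_hermite_normal_exp: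
  "inner_L2 (normal_law a) (hermite_fn n) (normal_exp t) = of_real ((a * t) ^ n)"
  unfolding hermite_fn_eq inner_exp_poly_normal_exp normal_law_hermite_shift[OF a_pos] by simp

lemma inner_normal_exp_self:
  "inner_L2 (normal_law a) (normal_exp t) (normal_exp t) = of_real (exp (a * t\<^sup>2))"
  using integral_normal_law_const[OF a_pos, of 1]
  by (subst (1) normal_exp_eq, unfold inner_exp_poly_normal_exp)
    (simp add: power2_eq_square algebra_simps flip: of_real_mult exp_add)

lemma inner_poisson_exp_self:
  "inner_L2 (poisson_law a) (poisson_exp t) (poisson_exp t) = of_real (exp (a * t\<^sup>2))"
proof -
  \<comment> \<open>The generating function is taken at (1 + t)^2, with exponent 2 a t + a t^2. One
    factor exp(-a t) is explicit; the other is absorbed by the exp(a t) in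
    \<open>inner_poisson_exp_sums\<close>.\<close>
  have "(\<lambda>k. exp (- a * t) * (exp (- a) * a ^ k / fact k * ((1 + t)\<^sup>2) ^ k))
      sums (exp (- a * t) * exp (a * ((1 + t)\<^sup>2 - 1)))"
    by (intro sums_mult poisson_law_pgf_sums)
  from sums_of_real[OF this, where 'a = complex]
  have "(\<lambda>k. poisson_exp t k * of_real (exp (- a) * a ^ k / fact k) * of_real (1 + t) ^ k)
      sums of_real (exp (- a * t) * exp (a * ((1 + t)\<^sup>2 - 1)))"
    by (simp add: power_mult_distrib power2_eq_square mult_ac)
  from sums_unique2[OF inner_poisson_exp_sums[OF a_pos poisson_exp_L2[OF a_pos]] this]
  have "inner_L2 (poisson_law a) (poisson_exp t) (poisson_exp t) * of_real (exp (a * t))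
      = of_real (exp (a * t\<^sup>2)) * of_real (exp (a * t))"
    by (simp add: power2_eq_square algebra_simps flip: of_real_mult exp_add)
  then show ?thesis by simp
qed

text \<open>This explains the constants of the kernel: the shift 2 a combines with the tilt a (t -
  1) to a (1 + t), division by a^k normalises the resulting power, and exp(-a/2) cancels the
  constant left by the squares in the exponent.\<close>

lemma inner_inv_kernel_normal_exp:
  "inner_L2 (normal_law a) (inv_kernel a k) (normal_exp t) * of_real (exp (a * t)) = of_real ((1 + t) ^ k)"
proof -
  let ?E = "exp (a * (- 1 + t)\<^sup>2 / 2 - a * t\<^sup>2 / 2)"
  let ?c = "exp (- a / 2) / a ^ k"
  have "poly (smult ?c (pcompose (hermite_poly a k) [:2 * a, 1:])) (x + a * (- 1 + t))
      = ?c * poly (hermite_poly a k) (x + a * (1 + t))" for x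
    by (simp add: poly_pcompose algebra_simps)
  then have int: "(LINT x|normal_law a. poly (smult ?c (pcompose (hermite_poly a k) [:2 * a, 1:])) (x + a * (- 1 + t)))
      = ?c * (a * (1 + t)) ^ k"
    by (simp only: integral_mult_right_zero normal_law_hermite_shift[OF a_pos])
  have "?E * exp (- a / 2) * exp (a * t) = 1"
    by (simp add: power2_eq_square field_simps flip: exp_add)
  moreover have "?E * (?c * (a * (1 + t)) ^ k) * exp (a * t) = (?E * exp (- a / 2) * exp (a * t)) * (1 + t) ^ k"
    using a_pos by (simp add: power_mult_distrib)
  ultimately have "?E * (?c * (a * (1 + t)) ^ k) * exp (a * t) = (1 + t) ^ k"
    by (simp only: mult_1_left)
  then show ?thesis
    unfolding inv_kernel_eq inner_exp_poly_normal_exp int of_real_mult[symmetric] by (simp only:)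
qed

lemma poisson_point_weights_sums:
  "(\<lambda>j. (if j = k then 1 / of_real (exp (- a) * a ^ k / fact k) else 0)
     * of_real (exp (- a) * a ^ j / fact j) * complex_of_real s ^ j) sums of_real (s ^ k)"
proof -
  have "(\<lambda>j. (if j = k then 1 / of_real (exp (- a) * a ^ k / fact k) else 0)
      * of_real (exp (- a) * a ^ j / fact j) * complex_of_real s ^ j)
    = (\<lambda>j. if j = k then of_real (s ^ j) else 0)"
    using a_pos by auto
  then show ?thesis using sums_single[of k "\<lambda>j. complex_of_real (s ^ j)"] by simp
qed

section \<open>Equivalence of the two descriptions of \<Phi>\<close>

lemma \<Phi>_exp_imp_hermite:
  assumes "\<And>t. \<Phi> (normal_exp t) = poisson_exp t"
  shows "\<Phi> (hermite_fn n) = (\<lambda>k. of_real (charlier a n (real k)))"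
proof (rule L2_poisson_eqI[OF a_pos \<Phi>_L2[OF hermite_fn_L2]])
  fix t :: real
  have "inner_L2 (poisson_law a) (\<Phi> (hermite_fn n)) (poisson_exp t) = of_real ((a * t) ^ n)"
    unfolding assms[symmetric] \<Phi>_inner[OF hermite_fn_L2 normal_exp_L2] by (rule inner_hermite_normal_exp)
  then show "(\<lambda>k. of_real (charlier a n (real k)) * of_real (exp (- a) * a ^ k / fact k) * of_real (1 + t) ^ k)
    sums (inner_L2 (poisson_law a) (\<Phi> (hermite_fn n)) (poisson_exp t) * of_real (exp (a * t)))"
    using sums_of_real[OF charlier_poisson_sums[OF a_pos, of n "1 + t"], where 'a = complex]
    by simp
qed

text \<open>Both functions have Charlier pairings (a t)^n and squared norm exp(a t^2), which is
  exactly the norm carried by the expansion. Hence both are limits of the same partial sums and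
  agree at every k.\<close>

lemma \<Phi>_hermite_imp_exp:
  assumes "\<And>n. \<Phi> (hermite_fn n) = (\<lambda>k. of_real (charlier a n (real k)))"
  shows "\<Phi> (normal_exp t) = poisson_exp t"
proof
  let ?C = "\<lambda>n k. complex_of_real (charlier a n (real k))"
  have C_L2: "?C n \<in> L2 (poisson_law a)" for n
    unfolding assms[symmetric] by (rule \<Phi>_L2[OF hermite_fn_L2])
  \<comment> \<open>Orthogonality of the Charlier polynomials is inherited from the Hermite
    polynomials through \<Phi>.\<close>
  have orth: "inner_L2 (poisson_law a) (?C n) (?C m) = (if n = m then of_real (a ^ n * fact n) else 0)" for n m
    unfolding assms[symmetric] \<Phi>_inner[OF hermite_fn_L2 hermite_fn_L2]
    by (simp add: inner_L2_of_real hermite_var_eq_poly a_pos normal_law_hermite_orthogonal)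
  have exp_C: "inner_L2 (poisson_law a) (poisson_exp t) (?C n) = of_real ((a * t) ^ n)" for n
  proof -
    have "(\<lambda>k. ?C n k * of_real (exp (- a) * a ^ k / fact k) * of_real (1 + t) ^ k)
        sums (of_real ((a * t) ^ n) * of_real (exp (a * t)))"
      using sums_of_real[OF charlier_poisson_sums[OF a_pos, of n "1 + t"], where 'a = complex] by simp
    from sums_unique2[OF inner_poisson_exp_sums[OF a_pos C_L2] this]
    have "inner_L2 (poisson_law a) (?C n) (poisson_exp t) = of_real ((a * t) ^ n)"
      by simp
    then show ?thesis by (subst inner_L2_commute) simp
  qed
  have \<Phi>_C: "inner_L2 (poisson_law a) (\<Phi> (normal_exp t)) (?C n) = of_real ((a * t) ^ n)" for n
    unfolding assms[symmetric] \<Phi>_inner[OF normal_exp_L2 hermite_fn_L2]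
    by (subst inner_L2_commute) (simp add: inner_hermite_normal_exp)
  have \<Phi>_self: "inner_L2 (poisson_law a) (\<Phi> (normal_exp t)) (\<Phi> (normal_exp t)) = of_real (exp (a * t\<^sup>2))"
    unfolding \<Phi>_inner[OF normal_exp_L2 normal_exp_L2] by (rule inner_normal_exp_self)
  fix k
  show "\<Phi> (normal_exp t) k = poisson_exp t k"
    using L2_poisson_converges_pointwise[OF a_pos
        L2_exponential_expansion[OF C_L2 orth \<Phi>_L2[OF normal_exp_L2] \<Phi>_C \<Phi>_self]]
      L2_poisson_converges_pointwise[OF a_pos
        L2_exponential_expansion[OF C_L2 orth poisson_exp_L2[OF a_pos] exp_C inner_poisson_exp_self]]
    by (rule LIMSEQ_unique)
qed

section \<open>The kernel: expansion and uniqueness\<close>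

lemma \<Phi>_inv_kernel:
  assumes "\<And>t. \<Phi> (normal_exp t) = poisson_exp t"
  shows "\<Phi> (inv_kernel a k) = (\<lambda>j. if j = k then 1 / of_real (exp (- a) * a ^ k / fact k) else 0)"
proof (rule L2_poisson_eqI[OF a_pos \<Phi>_L2[OF inv_kernel_L2]])
  fix t :: real
  have "inner_L2 (poisson_law a) (\<Phi> (inv_kernel a k)) (poisson_exp t) * of_real (exp (a * t)) = of_real ((1 + t) ^ k)"
    unfolding assms[symmetric] \<Phi>_inner[OF inv_kernel_L2 normal_exp_L2] by (rule inner_inv_kernel_normal_exp)
  then show "(\<lambda>j. (if j = k then 1 / of_real (exp (- a) * a ^ k / fact k) else 0)
      * of_real (exp (- a) * a ^ j / fact j) * of_real (1 + t) ^ j)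
    sums (inner_L2 (poisson_law a) (\<Phi> (inv_kernel a k)) (poisson_exp t) * of_real (exp (a * t)))"
    using poisson_point_weights_sums[of k "1 + t"] by (simp only:)
qed

text \<open>The weight in each summand cancels the reciprocal weight of the point mass. Membership
  in \<open>L2\<close> is carried through the induction because linearity of \<Phi> is available
  only there.\<close>

lemma \<Phi>_partial_sum:
  assumes "\<And>t. \<Phi> (normal_exp t) = poisson_exp t"
  shows "(\<lambda>x. \<Sum>k<n. inv_kernel a k x * F k * of_real (exp (- a) * a ^ k / fact k)) \<in> L2 (normal_law a) \<and>
    \<Phi> (\<lambda>x. \<Sum>k<n. inv_kernel a k x * F k * of_real (exp (- a) * a ^ k / fact k))
      = (\<lambda>k. if k < n then F k else 0)"
proof (induction n)
  case 0
  \<comment> \<open>The image of the zero function comes from linearity with both coefficients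
    0.\<close>
  show ?case
    using L2_zero \<Phi>_lincomb[OF L2_zero L2_zero, of 0 0] by simp
next
  case (Suc n)
  let ?S = "\<lambda>n x. \<Sum>k<n. inv_kernel a k x * F k * of_real (exp (- a) * a ^ k / fact k)"
  let ?p = "complex_of_real (exp (- a) * a ^ n / fact n)"
  have S: "?S n \<in> L2 (normal_law a)" "\<Phi> (?S n) = (\<lambda>k. if k < n then F k else 0)"
    using Suc by auto
  have eq: "?S (Suc n) = (\<lambda>x. 1 * ?S n x + (F n * ?p) * inv_kernel a n x)"
    by (simp only: sum.lessThan_Suc mult_1_left mult_ac)
  have "?p \<noteq> 0" using a_pos by simp
  then show ?case
    unfolding eq \<Phi>_lincomb[OF S(1) inv_kernel_L2] S(2) \<Phi>_inv_kernel[OF assms]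
    by (intro conjI L2_lincomb S(1) inv_kernel_L2) (auto simp: fun_eq_iff less_Suc_eq)
qed

text \<open>\<Phi> is isometric and sends the error of the n-th partial sum to the truncation error
  of F, which tends to 0.\<close>

lemma inv_kernel_is_kernel:
  assumes "\<And>t. \<Phi> (normal_exp t) = poisson_exp t"
  shows "is_kernel_of_inverse a \<Phi> (inv_kernel a)"
  unfolding is_kernel_of_inverse_def L2_converges_def
proof (intro ballI conjI allI)
  fix F assume F: "F \<in> L2 (poisson_law a)"
  let ?S = "\<lambda>n x. \<Sum>k<n. inv_kernel a k x * F k * of_real (exp (- a) * a ^ k / fact k)"
  let ?f = "inv_L2 (normal_law a) (poisson_law a) \<Phi> F"
  show S: "?S n \<in> L2 (normal_law a)" for n
    using \<Phi>_partial_sum[OF assms] by blast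
  show f: "?f \<in> L2 (normal_law a)"
    by (rule inv_L2_\<Phi>[OF F])
  have "\<Phi> (\<lambda>x. ?S n x - ?f x) = (\<lambda>k. (if k < n then F k else 0) - F k)" for n
  proof -
    have "(\<lambda>x. ?S n x - ?f x) = (\<lambda>x. 1 * ?S n x + (- 1) * ?f x)"
      by (simp only: mult_1_left mult_minus1 add_uminus_conv_diff)
    then have "\<Phi> (\<lambda>x. ?S n x - ?f x) = (\<lambda>k. 1 * \<Phi> (?S n) k + (- 1) * \<Phi> ?f k)"
      by (simp only: \<Phi>_lincomb[OF S f])
    then show ?thesis
      by (simp only: mult_1_left mult_minus1 add_uminus_conv_diff
          conjunct2[OF \<Phi>_partial_sum[OF assms]] inv_L2_\<Phi>(2)[OF F])
  qed
  then have "norm_L2 (normal_law a) (\<lambda>x. ?S n x - ?f x)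
      = norm_L2 (poisson_law a) (\<lambda>k. (if k < n then F k else 0) - F k)" for n
    by (simp only: \<Phi>_norm[OF L2_diff[OF S f], symmetric])
  then show "(\<lambda>n. norm_L2 (normal_law a) (\<lambda>x. ?S n x - ?f x)) \<longlonglongrightarrow> 0"
    using L2_poisson_truncation[OF F] by (simp only:)
qed

text \<open>For the point mass at k, every partial sum beyond k equals the k-th kernel function
  times its weight, so that product must be the preimage of the point mass.\<close>

lemma kernel_ae_unique:
  assumes K: "is_kernel_of_inverse a \<Phi> K" and L: "is_kernel_of_inverse a \<Phi> L"
  shows "ae_eq (normal_law a) (K k) (L k)"
proof -
  define \<delta> :: "nat \<Rightarrow> complex" where "\<delta> j = (if j = k then 1 else 0)" for j
  define p where "p = complex_of_real (exp (- a) * a ^ k / fact k)"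
  define f where "f = inv_L2 (normal_law a) (poisson_law a) \<Phi> \<delta>"
  have "p \<noteq> 0" using a_pos by (simp add: p_def)
  have \<delta>: "\<delta> \<in> L2 (poisson_law a)"
  proof -
    have "integrable (poisson_law a) (\<lambda>j. (cmod (\<delta> j))\<^sup>2)"
      unfolding integrable_poisson_law_iff[OF a_pos]
      by (rule summable_finite[of "{k}"]) (auto simp: \<delta>_def)
    then show ?thesis by (simp add: L2_def poisson_law_def)
  qed
  have *: "ae_eq (normal_law a) (\<lambda>x. J k x * p) f" if J: "is_kernel_of_inverse a \<Phi> J" for J
  proof -
    let ?S = "\<lambda>n x. \<Sum>j<n. J j x * \<delta> j * of_real (exp (- a) * a ^ j / fact j)"
    have S: "?S n = (\<lambda>x. J k x * p)" if "k < n" for n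
    proof
      fix x
      have "?S n x = (\<Sum>j<n. if j = k then J k x * p else 0)"
        by (intro sum.cong) (auto simp: \<delta>_def p_def)
      then show "?S n x = J k x * p" using that by simp
    qed
    have conv: "L2_converges (normal_law a) ?S f"
      using J \<delta> unfolding is_kernel_of_inverse_def f_def by blast
    then have "(\<lambda>n. norm_L2 (normal_law a) (\<lambda>x. ?S n x - f x)) \<longlonglongrightarrow> 0"
      by (simp add: L2_converges_def)
    moreover have "(\<lambda>n. norm_L2 (normal_law a) (\<lambda>x. ?S n x - f x)) \<longlonglongrightarrow> norm_L2 (normal_law a) (\<lambda>x. J k x * p - f x)"
    proof (rule tendsto_eventually)
      show "\<forall>\<^sub>F n in sequentially. norm_L2 (normal_law a) (\<lambda>x. ?S n x - f x)
          = norm_L2 (normal_law a) (\<lambda>x. J k x * p - f x)"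
        using eventually_gt_at_top[of k]
      proof eventually_elim
        case (elim n)
        show ?case using fun_cong[OF S[OF elim]] by simp
      qed
    qed
    ultimately have "norm_L2 (normal_law a) (\<lambda>x. J k x * p - f x) = 0"
      by (rule LIMSEQ_unique[symmetric])
    \<comment> \<open>The sum with k + 1 terms is the first to contain index k; its
      square-integrability passes to the product itself.\<close>
    moreover have "?S (Suc k) \<in> L2 (normal_law a)" "f \<in> L2 (normal_law a)"
      using conv unfolding L2_converges_def by blast+
    then have "(\<lambda>x. J k x * p) \<in> L2 (normal_law a)" "f \<in> L2 (normal_law a)"
      unfolding S[OF lessI] .
    ultimately show ?thesis by (intro norm_L2_zero_imp_ae_eq)
  qed
  from *[OF K] *[OF L] show ?thesis
    unfolding ae_eq_def by eventually_elim (use \<open>p \<noteq> 0\<close> mult_right_cancel in metis)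
qed

end

theorem proposition3:
  fixes a :: real
    and \<Phi> :: "(real \<Rightarrow> complex) \<Rightarrow> (nat \<Rightarrow> complex)"
  assumes "a > 0"
    and "unitary_L2 (normal_law a) (poisson_law a) \<Phi>"
  defines "\<kappa> \<equiv> \<lambda>k x. complex_of_real (exp (- a / 2 - x) * hermite_var a k (x + 2 * a) / a ^ k)"
  shows "(maps_hermite_to_charlier a \<Phi> \<longleftrightarrow> maps_exponentials a \<Phi>) \<and>
    (maps_hermite_to_charlier a \<Phi> \<longrightarrow>
       is_kernel_of_inverse a \<Phi> \<kappa> \<and>
       (\<forall>K. is_kernel_of_inverse a \<Phi> K \<longrightarrow>
          (\<forall>k. ae_eq (normal_law a) (K k) (\<kappa> k))))"
proof -
  note ctxt = assms(1,2)
  have \<kappa>: "\<kappa> = inv_kernel a"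
    by (intro ext) (simp only: \<kappa>_def inv_kernel_def)
  \<comment> \<open>Almost-everywhere equality on the Poisson side is equality, so both conditions
    become equations between functions.\<close>
  have iff: "maps_hermite_to_charlier a \<Phi> \<longleftrightarrow> maps_exponentials a \<Phi>"
    unfolding maps_hermite_to_charlier_def maps_exponentials_def ae_eq_poisson_law[OF assms(1)]
    using \<Phi>_exp_imp_hermite[OF ctxt] \<Phi>_hermite_imp_exp[OF ctxt] by blast
  have "is_kernel_of_inverse a \<Phi> \<kappa>" if "maps_hermite_to_charlier a \<Phi>"
    using that unfolding iff \<kappa> maps_exponentials_def ae_eq_poisson_law[OF assms(1)]
    by (intro inv_kernel_is_kernel[OF ctxt]) blast
  with iff show ?thesis
    using kernel_ae_unique[OF ctxt] by blast
qed

end
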